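(* Let $\varphi$ be a $C^2$ finite-time nonautonomous dynamical system on $X$ over $J$ and let $\alpha\in\mathbb{R}$. Then the linearization $\Phi_{x_0}$ determines the finite-time metric entropy, and for every $(t_0,x_0)\in X$ $$h^{\varphi,\alpha}_{t_0}(x_0)=h^{\Phi_{x_0},\alpha}_{t_0}.$$
   Context: Let $J\subset\mathbb{R}$ be compact, $|J|:=\max J-\min J$, let $(X(t))_{t\in J}$ be a family of subsets of $\mathbb{R}^n$ and $X:=\{(t,x)\in J\times\mathbb{R}^n: x\in X(t)\}$. A finite-time nonautonomous dynamical system (FTNDS) $\varphi$ on $X$ over $J$ is a family of maps $\varphi(t,s):X(s)\to X(t)$, $t,s\in J$, with $(t,s,x)\mapsto\varphi(t,s)x$ continuous, $\varphi(s,s)x=x$ and $\varphi(t,u)\varphi(u,s)x=\varphi(t,s)x$ for all $t,u,s\in J$, $x\in X(s)$. It is called $C^k$ if for all $t,s\in J$ the maps $\varphi(t,s):X(s)\to X(t)$ are $C^k$ and all derivatives depend continuously on $t,s\in J$. $\|\cdot\|$ is the Euclidean norm, $\mu$ is $n$-dimensional Lebesgue measure, $B(x_0,\varepsilon):=\{x\in\mathbb{R}^n:\|x-x_0\|\le\varepsilon\}$. For $\alpha\in\mathbb{R}$, $(t_0,x_0)\in X$, $\varepsilon\ge0$ let $$B^{\varphi,\alpha}_{t_0}(x_0,\varepsilon):=\Big\{x\in X(t_0):\sup_{t\in J}\|\varphi(t,t_0)x-\varphi(t,t_0)x_0\|e^{-\alpha(t-t_0)}\le\varepsilon\Big\}.$$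 The finite-time metric entropy (FTME) with weight $\alpha$ at $(t_0,x_0)$ is $$h^{\varphi,\alpha}_{t_0}(x_0):=\limsup_{\varepsilon\to0}-\frac1{|J|}\log\frac{\mu(B^{\varphi,\alpha}_{t_0}(x_0,\varepsilon))}{\mu(B(x_0,\varepsilon))}.$$ For $(t_0,x_0)\in X$, the linearization $\Phi_{x_0}$ is given by $\Phi_{x_0}(t,t_0):=D\varphi(t,t_0)x_0\in\mathbb{R}^{n\times n}$, the derivative of $x\mapsto\varphi(t,t_0)x$ at $x_0$, and $\Phi_{x_0}(t,s):=\Phi_{x_0}(t,t_0)\Phi_{x_0}(s,t_0)^{-1}$; it is a linear FTNDS over $J$. The FTME of a linear FTNDS does not depend on the point, and $h^{\Phi_{x_0},\alpha}_{t_0}$ denotes this constant value; explicitly $$h^{\Phi_{x_0},\alpha}_{t_0}=-\frac1{|J|}\log\frac{\mu\big(\{y\in\mathbb{R}^n:\|\Phi_{x_0}(t,t_0)y\|\le e^{\alpha(t-t_0)}\ \forall t\in J\}\big)}{\mu(B(0,1))}.$$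
   Formalization: The sets X(t) are assumed open (at a boundary point of a closed half-space, with φ the identity, the equality fails), and the derivatives are assumed continuous jointly in (t,s,x), not just in (t,s) for each fixed x, where the claim can also fail. *)

theory Defs
  imports "HOL-Analysis.Analysis"
begin

text \<open>
  The extended phase space \<open>{(t, x). t \<in> J \<and> x \<in> X t}\<close> is \<open>Sigma J X\<close>.
  The map \<open>\<phi>(t,s)\<close> is \<open>\<phi> t s\<close>; only its values for \<open>t, s \<in> J\<close> on \<open>X s\<close> are relevant.
\<close>

definition ftnds ::
  "real set \<Rightarrow> (real \<Rightarrow> (real^'n) set) \<Rightarrow> (real \<Rightarrow> real \<Rightarrow> real^'n \<Rightarrow> real^'n) \<Rightarrow> bool" where
  "ftnds J X \<phi> \<longleftrightarrow>
     compact J \<and>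
     (\<forall>t\<in>J. \<forall>s\<in>J. \<phi> t s ` X s \<subseteq> X t) \<and>
     continuous_on (J \<times> Sigma J X) (\<lambda>(t, s, x). \<phi> t s x) \<and>
     (\<forall>s\<in>J. \<forall>x\<in>X s. \<phi> s s x = x) \<and>
     (\<forall>t\<in>J. \<forall>u\<in>J. \<forall>s\<in>J. \<forall>x\<in>X s. \<phi> t u (\<phi> u s x) = \<phi> t s x)"

text \<open>
  The derivatives in \<open>x\<close> up to order \<open>k\<close> exist and are jointly continuous in \<open>(t, s, x)\<close>.
  The derivative of order \<open>j\<close> is represented by its evaluations at \<open>j\<close> constant direction
  vectors, which in finite dimension carries the same continuity information.
  The definition is meant for open sets \<open>X s\<close>.
\<close>

primrec Ck_family ::
  "nat \<Rightarrow> real set \<Rightarrow> (real \<Rightarrow> (real^'n) set) \<Rightarrow> (real \<Rightarrow> real \<Rightarrow> real^'n \<Rightarrow> real^'n) \<Rightarrow> bool" where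
  "Ck_family 0 J X f \<longleftrightarrow> continuous_on (J \<times> Sigma J X) (\<lambda>(t, s, x). f t s x)"
| "Ck_family (Suc k) J X f \<longleftrightarrow>
     continuous_on (J \<times> Sigma J X) (\<lambda>(t, s, x). f t s x) \<and>
     (\<forall>t\<in>J. \<forall>s\<in>J. \<forall>x\<in>X s. f t s differentiable (at x)) \<and>
     (\<forall>v. Ck_family k J X (\<lambda>t s x. frechet_derivative (f t s) (at x) v))"

text \<open>Openness of the fibres makes the derivatives at points of \<open>X s\<close> meaningful.\<close>

definition Ck_ftnds ::
  "nat \<Rightarrow> real set \<Rightarrow> (real \<Rightarrow> (real^'n) set) \<Rightarrow> (real \<Rightarrow> real \<Rightarrow> real^'n \<Rightarrow> real^'n) \<Rightarrow> bool" where
  "Ck_ftnds k J X \<phi> \<longleftrightarrow> ftnds J X \<phi> \<and> (\<forall>s\<in>J. open (X s)) \<and> Ck_family k J X \<phi>"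

text \<open>The supremum is taken in \<open>ereal\<close>, so that it is meaningful without a boundedness proof.\<close>

definition ft_ball ::
  "real set \<Rightarrow> (real \<Rightarrow> (real^'n) set) \<Rightarrow> (real \<Rightarrow> real \<Rightarrow> real^'n \<Rightarrow> real^'n) \<Rightarrow>
   real \<Rightarrow> real \<Rightarrow> real^'n \<Rightarrow> real \<Rightarrow> (real^'n) set" where
  "ft_ball J X \<phi> \<alpha> t0 x0 \<epsilon> =
     {x \<in> X t0. (SUP t\<in>J. ereal (norm (\<phi> t t0 x - \<phi> t t0 x0) * exp (- \<alpha> * (t - t0)))) \<le> ereal \<epsilon>}"

text \<open>Logarithm with the usual conventions \<open>ln 0 = -\<infinity>\<close> and \<open>ln \<infinity> = \<infinity>\<close>.\<close>

definition ln_ennreal :: "ennreal \<Rightarrow> ereal" where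
  "ln_ennreal x = (if x = 0 then -\<infinity> else if x = \<infinity> then \<infinity> else ereal (ln (enn2real x)))"

text \<open>For compact nonempty \<open>J\<close>, this is \<open>max J - min J\<close>; \<^const>\<open>Max\<close> is for finite sets only.\<close>

definition time_length :: "real set \<Rightarrow> real" where
  "time_length J = Sup J - Inf J"

definition ftme ::
  "real set \<Rightarrow> (real \<Rightarrow> (real^'n) set) \<Rightarrow> (real \<Rightarrow> real \<Rightarrow> real^'n \<Rightarrow> real^'n) \<Rightarrow>
   real \<Rightarrow> real \<Rightarrow> real^'n \<Rightarrow> ereal" where
  "ftme J X \<phi> \<alpha> t0 x0 =
     Limsup (at_right 0) (\<lambda>\<epsilon>. ereal (- (1 / time_length J)) *
       ln_ennreal (emeasure lebesgue (ft_ball J X \<phi> \<alpha> t0 x0 \<epsilon>) / emeasure lebesgue (cball x0 \<epsilon>)))"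

definition linearization ::
  "(real \<Rightarrow> real \<Rightarrow> real^'n \<Rightarrow> real^'n) \<Rightarrow> real \<Rightarrow> real^'n \<Rightarrow> real \<Rightarrow> real \<Rightarrow> real^'n^'n" where
  "linearization \<phi> t0 x0 t s =
     matrix (frechet_derivative (\<phi> t t0) (at x0)) **
     matrix_inv (matrix (frechet_derivative (\<phi> s t0) (at x0)))"

definition linear_flow ::
  "(real \<Rightarrow> real \<Rightarrow> real^'n^'n) \<Rightarrow> real \<Rightarrow> real \<Rightarrow> real^'n \<Rightarrow> real^'n" where
  "linear_flow \<Phi> t s y = \<Phi> t s *v y"

text \<open>
  The entropy of a linear system does not depend on the point \<open>y\<close>, and no limit is needed.
\<close>

lemma ftme_linear_flow:
  fixes \<Phi> :: "real \<Rightarrow> real \<Rightarrow> real^'n^'n"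
  shows "ftme J (\<lambda>_. UNIV) (linear_flow \<Phi>) \<alpha> t0 y =
    ereal (- (1 / time_length J)) *
      ln_ennreal (emeasure lebesgue {z. \<forall>t\<in>J. norm (\<Phi> t t0 *v z) \<le> exp (\<alpha> * (t - t0))} /
        emeasure lebesgue (cball (0 :: real^'n) 1))"
proof -
  let ?S = "{z. \<forall>t\<in>J. norm (\<Phi> t t0 *v z) \<le> exp (\<alpha> * (t - t0))}"
  let ?B = "cball (0 :: real^'n) 1"
  have ball: "ft_ball J (\<lambda>_. UNIV) (linear_flow \<Phi>) \<alpha> t0 y \<epsilon> = (\<lambda>z. \<epsilon> *\<^sub>R z + y) ` ?S"
    if e: "\<epsilon> > 0" for \<epsilon>
  proof -
    have mem: "x \<in> ft_ball J (\<lambda>_. UNIV) (linear_flow \<Phi>) \<alpha> t0 y \<epsilon> \<longleftrightarrow> (1/\<epsilon>) *\<^sub>R (x - y) \<in> ?S" for x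
    proof -
      have "norm (\<Phi> t t0 *v x - \<Phi> t t0 *v y) * exp (- \<alpha> * (t - t0)) \<le> \<epsilon> \<longleftrightarrow>
            norm (\<Phi> t t0 *v ((1/\<epsilon>) *\<^sub>R (x - y))) \<le> exp (\<alpha> * (t - t0))" for t
      proof -
        have "\<Phi> t t0 *v ((1/\<epsilon>) *\<^sub>R (x - y)) = (1/\<epsilon>) *\<^sub>R (\<Phi> t t0 *v x - \<Phi> t t0 *v y)"
          by (simp add: matrix_vector_mult_diff_distrib matrix_vector_mult_scaleR del: scaleR_diff_right)
        moreover have "exp (- \<alpha> * (t - t0)) = 1 / exp (\<alpha> * (t - t0))"
          by (simp only: mult_minus_left exp_minus inverse_eq_divide)
        ultimately show ?thesis
          using e by (simp only: norm_scaleR) (simp add: pos_divide_le_eq mult.commute)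
      qed
      then show ?thesis
        by (simp add: ft_ball_def linear_flow_def SUP_le_iff)
    qed
    show ?thesis
    proof (intro set_eqI iffI)
      fix x assume "x \<in> ft_ball J (\<lambda>_. UNIV) (linear_flow \<Phi>) \<alpha> t0 y \<epsilon>"
      then have "(1/\<epsilon>) *\<^sub>R (x - y) \<in> ?S" using mem by blast
      moreover have "x = \<epsilon> *\<^sub>R ((1/\<epsilon>) *\<^sub>R (x - y)) + y" using e by simp
      ultimately show "x \<in> (\<lambda>z. \<epsilon> *\<^sub>R z + y) ` ?S" by blast
    next
      fix x assume "x \<in> (\<lambda>z. \<epsilon> *\<^sub>R z + y) ` ?S"
      then obtain z where z: "z \<in> ?S" and x: "x = \<epsilon> *\<^sub>R z + y" by blast
      have "(1/\<epsilon>) *\<^sub>R (x - y) = z" using e x by simp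
      then show "x \<in> ft_ball J (\<lambda>_. UNIV) (linear_flow \<Phi>) \<alpha> t0 y \<epsilon>" using mem z by blast
    qed
  qed
  have quot: "emeasure lebesgue (ft_ball J (\<lambda>_. UNIV) (linear_flow \<Phi>) \<alpha> t0 y \<epsilon>) /
      emeasure lebesgue (cball y \<epsilon>) = emeasure lebesgue ?S / emeasure lebesgue ?B"
    if e: "\<epsilon> > 0" for \<epsilon>
  proof -
    let ?c = "ennreal (\<bar>\<epsilon>\<bar> ^ DIM(real^'n))"
    have c: "?c \<noteq> 0" "?c \<noteq> \<infinity>" using e by (simp_all add: ennreal_eq_0_iff not_le)
    have "cball y \<epsilon> = (\<lambda>z. \<epsilon> *\<^sub>R z + y) ` ?B"
    proof -
      have "(\<lambda>z. \<epsilon> *\<^sub>R z + y) ` ?B = (+) y ` ((*\<^sub>R) \<epsilon> ` ?B)"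
        by (simp add: image_image add.commute)
      then show ?thesis using e by (simp add: cball_scale flip: cball_translation)
    qed
    then have B: "emeasure lebesgue (cball y \<epsilon>) = ?c * emeasure lebesgue ?B"
      using emeasure_lebesgue_affine[of \<epsilon> y ?B] by simp
    have S: "emeasure lebesgue (ft_ball J (\<lambda>_. UNIV) (linear_flow \<Phi>) \<alpha> t0 y \<epsilon>) =
        ?c * emeasure lebesgue ?S"
      using emeasure_lebesgue_affine[of \<epsilon> y ?S] ball[OF e] by simp
    show ?thesis
      unfolding B S by (subst (1 2) mult.commute) (rule divide_mult_eq[OF c])
  qed
  have "ftme J (\<lambda>_. UNIV) (linear_flow \<Phi>) \<alpha> t0 y =
      Limsup (at_right (0::real)) (\<lambda>_. ereal (- (1 / time_length J)) *
        ln_ennreal (emeasure lebesgue ?S / emeasure lebesgue ?B))"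
    unfolding ftme_def
    by (intro Limsup_eq eventually_mono[OF eventually_at_right_less]) (simp only: quot)
  then show ?thesis
    by (simp only: Limsup_const[OF trivial_limit_at_right_real])
qed

end

theory Submission
  imports Defs
begin

text \<open>
  Compactness of \<open>J\<close> makes the first-order Taylor approximation of \<open>\<phi>(t,t0)\<close> at \<open>x0\<close> uniform in
  \<open>t\<close>. With \<open>S = {z. \<forall>t\<in>J. \<parallel>\<Phi>(t,t0) z\<parallel> \<le> exp (\<alpha> (t - t0))}\<close>, which lies in the unit ball because
  \<open>t0 \<in> J\<close>, this gives for every \<open>\<kappa> \<in> (0,1)\<close> and all small \<open>\<epsilon>\<close> the inclusions
  \<open>x0 + \<epsilon> (1 - \<kappa>) S \<subseteq> B(x0, \<epsilon>) \<subseteq> x0 + \<epsilon> (1 + \<kappa>) S\<close> for the finite-time ball \<open>B(x0, \<epsilon>)\<close>. Hence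
  \<open>\<mu> (B(x0, \<epsilon>)) / \<epsilon> ^ n\<close> converges to \<open>\<mu> S\<close>, which is positive and finite, and the logarithm is
  continuous there.
\<close>

text \<open>Heine-Cantor on the product of \<open>J\<close> with a closed ball in \<open>U\<close>:
  only pairs \<open>(t, x0)\<close>, \<open>(t, x)\<close> with equal time are compared, so one
  radius serves all \<open>t\<close>.\<close>

lemma compact_eventually_close_fibre:
  fixes g :: "'b::metric_space \<Rightarrow> 'a::euclidean_space \<Rightarrow> 'c::real_normed_vector"
  assumes J: "compact J" and U: "open U" "x0 \<in> U"
    and g: "continuous_on (J \<times> U) (\<lambda>(t, x). g t x)" and e: "e > 0"
  shows "\<forall>\<^sub>F x in nhds x0. \<forall>t\<in>J. norm (g t x - g t x0) \<le> e"
proof -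
  obtain r where r: "r > 0" "cball x0 r \<subseteq> U"
    using U open_contains_cball by blast
  have "compact (J \<times> cball x0 r)"
    using J by (intro compact_Times) auto
  then have "uniformly_continuous_on (J \<times> cball x0 r) (\<lambda>(t, x). g t x)"
    using r by (intro compact_uniformly_continuous continuous_on_subset[OF g]) auto
  from uniformly_continuous_onE[OF this e]
  obtain d where d: "d > 0" and *: "\<And>p q. p \<in> J \<times> cball x0 r \<Longrightarrow> q \<in> J \<times> cball x0 r \<Longrightarrow>
      dist q p < d \<Longrightarrow> dist (case q of (t, x) \<Rightarrow> g t x) (case p of (t, x) \<Rightarrow> g t x) < e"
    by metis
  have "norm (g t x - g t x0) \<le> e" if "dist x x0 < min d r" "t \<in> J" for x t
    using *[of "(t, x0)" "(t, x)"] that r by (auto simp: dist_Pair_Pair dist_norm dist_commute norm_minus_commute)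
  then show ?thesis
    unfolding eventually_nhds_metric using d r by (intro exI[of _ "min d r"]) auto
qed

text \<open>By the mean value inequality the error is at most \<open>norm (x - x0)\<close> times a
  bound for \<open>onorm (f' t y - f' t x0)\<close> on the ball. Continuity is given only for each
  fixed direction \<open>v\<close>, so this operator norm is controlled through the finitely many
  basis vectors.\<close>

lemma uniform_linear_approximation:
  fixes f :: "'b::metric_space \<Rightarrow> 'a::euclidean_space \<Rightarrow> 'c::real_normed_vector"
  assumes J: "compact J" and U: "open U" "x0 \<in> U"
    and f': "\<And>t x. t \<in> J \<Longrightarrow> x \<in> U \<Longrightarrow> (f t has_derivative f' t x) (at x)"
    and cont: "\<And>v. continuous_on (J \<times> U) (\<lambda>(t, x). f' t x v)" and e: "e > 0"
  shows "\<exists>\<delta>>0. cball x0 \<delta> \<subseteq> U \<and>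
    (\<forall>t\<in>J. \<forall>x\<in>cball x0 \<delta>. norm (f t x - f t x0 - f' t x0 (x - x0)) \<le> e * norm (x - x0))"
proof -
  \<comment> \<open>The operator norm is at most the sum of the norms over \<open>Basis\<close>;
    \<open>DIM('a)\<close> terms of this size add up to \<open>e\<close>.\<close>
  let ?e = "e / DIM('a)"
  have "\<forall>\<^sub>F x in nhds x0. x \<in> U \<and> (\<forall>v\<in>Basis. \<forall>t\<in>J. norm (f' t x v - f' t x0 v) \<le> ?e)"
    using J U cont e
    by (intro eventually_conj eventually_nhds_in_open eventually_ball_finite ballI
        compact_eventually_close_fibre[where U=U and g="\<lambda>t x. f' t x v" for v]) auto
  then obtain d where d: "d > 0"
    and *: "\<And>x. dist x x0 < d \<Longrightarrow> x \<in> U \<and> (\<forall>v\<in>Basis. \<forall>t\<in>J. norm (f' t x v - f' t x0 v) \<le> ?e)"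
    unfolding eventually_nhds_metric by blast
  \<comment> \<open>Halving \<open>d\<close> turns the open ball of validity into a closed
    one.\<close>
  let ?S = "cball x0 (d / 2)"
  have near: "x \<in> U" "v \<in> Basis \<Longrightarrow> t \<in> J \<Longrightarrow> norm (f' t x v - f' t x0 v) \<le> ?e"
    if "x \<in> ?S" for x v t
    using *[of x] that d by (auto simp: dist_commute)
  have "norm (f t x - f t x0 - f' t x0 (x - x0)) \<le> e * norm (x - x0)"
    if t: "t \<in> J" and x: "x \<in> ?S" for t x
  proof -
    have "norm (f t x - f t x0 - f' t x0 (x - x0)) \<le> norm (x - x0) * e"
    proof (rule differentiable_bound_linearization[of x0 x ?S "f t" "f' t"])
      show "x0 \<in> ?S" using d by simp
      show "x0 + s *\<^sub>R (x - x0) \<in> ?S" if "s \<in> {0..1}" for s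
      proof -
        have "s * norm (x - x0) \<le> 1 * norm (x - x0)"
          using that by (intro mult_right_mono) auto
        then show ?thesis
          using x that by (simp add: dist_norm norm_minus_commute)
      qed
      show "(f t has_derivative f' t y) (at y within ?S)" if "y \<in> ?S" for y
        using f'[OF t near(1)[OF that]] by (rule has_derivative_at_withinI)
      show "onorm (f' t y - f' t x0) \<le> e" if y: "y \<in> ?S" for y
      proof -
        have "bounded_linear (f' t y)" "bounded_linear (f' t x0)"
          using f'[OF t] near(1)[OF y] U by (auto intro: has_derivative_bounded_linear)
        then have "bounded_linear (f' t y - f' t x0)"
          unfolding fun_diff_def by (rule bounded_linear_sub)
        then have "onorm (f' t y - f' t x0) \<le> (\<Sum>v\<in>Basis. norm ((f' t y - f' t x0) v))"
          by (rule onorm_componentwise)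
        also have "\<dots> \<le> (\<Sum>v\<in>(Basis::'a set). ?e)"
          using near(2)[OF y _ t] by (intro sum_mono) simp
        finally show ?thesis by simp
      qed
    qed
    then show ?thesis by (simp add: mult.commute)
  qed
  then show ?thesis
    using d near(1) by (intro exI[of _ "d / 2"] conjI subsetI) auto
qed

text \<open>Homothety scales Lebesgue measure by the \<open>n\<close>-th power of the factor, so for
  each \<kappa> the ratio eventually lies between \<open>(1 - \<kappa>) ^ n\<close> and
  \<open>(1 + \<kappa>) ^ n\<close> times the claimed limit. The inclusions do not make
  \<open>B \<epsilon>\<close> measurable, hence the separate assumption.\<close>

lemma tendsto_measure_ratio_sandwich:
  fixes S :: "'a::euclidean_space set"
  assumes S: "compact S"
    and B: "\<forall>\<^sub>F \<epsilon> in at_right 0. B \<epsilon> \<in> sets lebesgue"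
    and sandwich: "\<And>\<kappa>. 0 < \<kappa> \<Longrightarrow> \<kappa> < 1 \<Longrightarrow> \<forall>\<^sub>F \<epsilon> in at_right 0.
      (\<lambda>z. (\<epsilon> * (1 - \<kappa>)) *\<^sub>R z + x0) ` S \<subseteq> B \<epsilon> \<and> B \<epsilon> \<subseteq> (\<lambda>z. (\<epsilon> * (1 + \<kappa>)) *\<^sub>R z + x0) ` S"
  shows "((\<lambda>\<epsilon>. measure lebesgue (B \<epsilon>) / measure lebesgue (cball x0 \<epsilon>)) \<longlongrightarrow>
    measure lebesgue S / measure lebesgue (cball (0::'a) 1)) (at_right 0)"
    (is "(?p \<longlongrightarrow> ?r) _")
proof -
  let ?n = "DIM('a)"
  have compact_affine: "compact ((\<lambda>z. c *\<^sub>R z + x0) ` T)" if "compact T" for c and T :: "'a set"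
    using that by (intro compact_continuous_image continuous_intros)
  have affine: "measure lebesgue ((\<lambda>z. c *\<^sub>R z + x0) ` T) = c ^ ?n * measure lebesgue T"
    if "c > 0" for c and T :: "'a set"
    using emeasure_lebesgue_affine[of c x0 T] that by (simp add: measure_def enn2real_mult)
  have ball: "measure lebesgue (cball x0 \<epsilon>) = \<epsilon> ^ ?n * measure lebesgue (cball (0::'a) 1)"
    if "\<epsilon> > 0" for \<epsilon>
  proof -
    have "(\<lambda>z. \<epsilon> *\<^sub>R z + x0) ` cball 0 1 = (+) x0 ` ((*\<^sub>R) \<epsilon> ` cball 0 1)"
      by (simp add: image_image add.commute)
    then have "cball x0 \<epsilon> = (\<lambda>z. \<epsilon> *\<^sub>R z + x0) ` cball 0 1"
      using that by (simp add: cball_scale flip: cball_translation)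
    then show ?thesis using affine[OF that] by simp
  qed
  have unit: "measure lebesgue (cball (0::'a) 1) > 0"
    using content_cball_pos[of 1 "0::'a"] by simp
  have scaled: "c ^ ?n * measure lebesgue S / measure lebesgue (cball (0::'a) 1) = c ^ ?n * ?r" for c
    by simp
  have bounds: "\<forall>\<^sub>F \<epsilon> in at_right 0. (1 - \<kappa>) ^ ?n * ?r \<le> ?p \<epsilon> \<and> ?p \<epsilon> \<le> (1 + \<kappa>) ^ ?n * ?r"
    if \<kappa>: "0 < \<kappa>" "\<kappa> < 1" for \<kappa>
    using sandwich[OF \<kappa>] B eventually_at_right_less
  proof eventually_elim
    case (elim \<epsilon>)
    \<comment> \<open>The outer copy of \<open>S\<close> bounds \<open>B \<epsilon>\<close>.
      Finiteness matters because \<open>measure\<close> takes the default value 0 on sets of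
      infinite measure and is monotone only below it.\<close>
    have Bm: "B \<epsilon> \<in> lmeasurable"
      using elim bounded_subset[OF compact_imp_bounded[OF compact_affine[OF S]]]
      by (intro bounded_set_imp_lmeasurable) auto
    have "(\<epsilon> * (1 - \<kappa>)) ^ ?n * measure lebesgue S \<le> measure lebesgue (B \<epsilon>)"
      using elim \<kappa> Bm lmeasurable_compact[OF compact_affine[OF S]]
      by (subst affine[symmetric]) (auto intro!: measure_mono_fmeasurable)
    moreover have "measure lebesgue (B \<epsilon>) \<le> (\<epsilon> * (1 + \<kappa>)) ^ ?n * measure lebesgue S"
      using elim \<kappa> Bm lmeasurable_compact[OF compact_affine[OF S]]
      by (subst affine[symmetric]) (auto intro!: measure_mono_fmeasurable)
    ultimately have "(1 - \<kappa>) ^ ?n * measure lebesgue S \<le> measure lebesgue (B \<epsilon>) / \<epsilon> ^ ?n"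
        "measure lebesgue (B \<epsilon>) / \<epsilon> ^ ?n \<le> (1 + \<kappa>) ^ ?n * measure lebesgue S"
      using elim by (simp_all add: pos_le_divide_eq pos_divide_le_eq power_mult_distrib mult_ac)
    from divide_right_mono[OF this(1) less_imp_le[OF unit]]
      divide_right_mono[OF this(2) less_imp_le[OF unit]]
    show ?case
      using elim by (simp only: ball divide_divide_eq_left times_divide_eq_right)
  qed
  have small: "\<forall>\<^sub>F \<kappa>::real in at_right 0. 0 < \<kappa> \<and> \<kappa> < 1"
    unfolding eventually_at_right_field by (intro exI[of _ 1]) auto
  show ?thesis
  proof (rule order_tendstoI)
    fix a assume a: "a < ?r"
    \<comment> \<open>Continuity in \<kappa> at 0 supplies one fixed \<kappa> in (0,1) whose lower
      bound still exceeds \<open>a\<close>; the bounds are then applied for this \<kappa>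
      alone.\<close>
    have "((\<lambda>\<kappa>. (1 - \<kappa>) ^ ?n * ?r) \<longlongrightarrow> (1 - 0) ^ ?n * ?r) (at_right 0)"
      by (intro tendsto_intros)
    then have "\<forall>\<^sub>F \<kappa> in at_right 0. a < (1 - \<kappa>) ^ ?n * ?r"
      using a by (intro order_tendstoD(1)) auto
    from eventually_happens[OF eventually_conj[OF this small]]
    obtain \<kappa> where \<kappa>: "0 < \<kappa>" "\<kappa> < 1" "a < (1 - \<kappa>) ^ ?n * ?r"
      by auto
    show "\<forall>\<^sub>F \<epsilon> in at_right 0. a < ?p \<epsilon>"
      using bounds[OF \<kappa>(1,2)] by (rule eventually_mono) (use \<kappa>(3) in \<open>meson less_le_trans\<close>)
  next
    fix a assume a: "?r < a"
    have "((\<lambda>\<kappa>. (1 + \<kappa>) ^ ?n * ?r) \<longlongrightarrow> (1 + 0) ^ ?n * ?r) (at_right 0)"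
      by (intro tendsto_intros)
    then have "\<forall>\<^sub>F \<kappa> in at_right 0. (1 + \<kappa>) ^ ?n * ?r < a"
      using a by (intro order_tendstoD(2)) auto
    from eventually_happens[OF eventually_conj[OF this small]]
    obtain \<kappa> where \<kappa>: "0 < \<kappa>" "\<kappa> < 1" "(1 + \<kappa>) ^ ?n * ?r < a"
      by auto
    show "\<forall>\<^sub>F \<epsilon> in at_right 0. ?p \<epsilon> < a"
      using bounds[OF \<kappa>(1,2)] by (rule eventually_mono) (use \<kappa>(3) in \<open>meson le_less_trans\<close>)
  qed
qed

lemma mem_ft_ball_iff:
  "x \<in> ft_ball J X \<phi> \<alpha> t0 x0 \<epsilon> \<longleftrightarrow>
    x \<in> X t0 \<and> (\<forall>t\<in>J. norm (\<phi> t t0 x - \<phi> t t0 x0) \<le> \<epsilon> * exp (\<alpha> * (t - t0)))"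
proof -
  have "norm (\<phi> t t0 x - \<phi> t t0 x0) * exp (- \<alpha> * (t - t0)) \<le> \<epsilon> \<longleftrightarrow>
      norm (\<phi> t t0 x - \<phi> t t0 x0) \<le> \<epsilon> * exp (\<alpha> * (t - t0))" for t
    unfolding mult_minus_left exp_minus divide_inverse[symmetric] by (simp add: pos_divide_le_eq)
  then show ?thesis
    by (simp add: ft_ball_def SUP_le_iff)
qed

lemma ln_ennreal_ennreal: "0 < x \<Longrightarrow> ln_ennreal (ennreal x) = ereal (ln x)"
  by (simp add: ln_ennreal_def)

lemma emeasure_divide_eq_measure:
  assumes "A \<in> fmeasurable M" "B \<in> fmeasurable M" "0 < measure M B"
  shows "emeasure M A / emeasure M B = ennreal (measure M A / measure M B)"
  using assms by (simp add: emeasure_eq_measure2 divide_ennreal)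

text \<open>Since \<open>r\<close> is positive, the ratios are eventually positive reals, away from
  the infinite values of \<open>ln_ennreal\<close>, and \<open>ln\<close> is continuous at
  \<open>r\<close>; the \<open>Limsup\<close> is thus a limit. The factor enters only as a real
  constant, so \<open>time_length J = 0\<close> is covered, with \<open>1 / 0 = 0\<close>.\<close>

lemma ftme_eq_of_tendsto:
  fixes X :: "real \<Rightarrow> (real^'n) set"
  assumes lim: "((\<lambda>\<epsilon>. measure lebesgue (ft_ball J X \<phi> \<alpha> t0 x0 \<epsilon>) / measure lebesgue (cball x0 \<epsilon>)) \<longlongrightarrow> r)
      (at_right 0)" (is "(?p \<longlongrightarrow> r) _")
    and meas: "\<forall>\<^sub>F \<epsilon> in at_right 0. ft_ball J X \<phi> \<alpha> t0 x0 \<epsilon> \<in> lmeasurable"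
    and r: "0 < r"
  shows "ftme J X \<phi> \<alpha> t0 x0 = ereal (- (1 / time_length J)) * ereal (ln r)"
proof -
  have "((\<lambda>\<epsilon>. ereal (- (1 / time_length J) * ln (?p \<epsilon>))) \<longlongrightarrow>
      ereal (- (1 / time_length J) * ln r)) (at_right 0)"
    using r by (intro tendsto_intros lim) auto
  moreover have "\<forall>\<^sub>F \<epsilon> in at_right 0. ereal (- (1 / time_length J) * ln (?p \<epsilon>)) =
      ereal (- (1 / time_length J)) *
       ln_ennreal (emeasure lebesgue (ft_ball J X \<phi> \<alpha> t0 x0 \<epsilon>) / emeasure lebesgue (cball x0 \<epsilon>))"
    using meas order_tendstoD(1)[OF lim r] eventually_at_right_less
  proof eventually_elim
    case (elim \<epsilon>)
    have "measure lebesgue (cball x0 \<epsilon>) > 0"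
      using content_cball_pos[of \<epsilon> x0] elim by simp
    then show ?case
      using elim by (simp only: emeasure_divide_eq_measure lmeasurable_cball ln_ennreal_ennreal times_ereal.simps)
  qed
  ultimately have "((\<lambda>\<epsilon>. ereal (- (1 / time_length J)) *
       ln_ennreal (emeasure lebesgue (ft_ball J X \<phi> \<alpha> t0 x0 \<epsilon>) / emeasure lebesgue (cball x0 \<epsilon>))) \<longlongrightarrow>
      ereal (- (1 / time_length J) * ln r)) (at_right 0)"
    by (rule Lim_transform_eventually)
  from lim_imp_Limsup[OF trivial_limit_at_right_real this] show ?thesis
    by (simp only: ftme_def times_ereal.simps)
qed

theorem theorem8:
  fixes J :: "real set"
    and X :: "real \<Rightarrow> (real^'n) set"
    and \<phi> :: "real \<Rightarrow> real \<Rightarrow> real^'n \<Rightarrow> real^'n"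
    and \<alpha> :: real
  assumes "Ck_ftnds 2 J X \<phi>"
  shows "\<forall>(t0, x0) \<in> Sigma J X. \<forall>y.
    ftme J X \<phi> \<alpha> t0 x0 = ftme J (\<lambda>_. UNIV) (linear_flow (linearization \<phi> t0 x0)) \<alpha> t0 y"
proof clarify
  fix t0 x0 and y :: "real^'n"
  assume t0: "t0 \<in> J" and x0: "x0 \<in> X t0"

  \<comment> \<open>The spatial derivative and its identification with the linearization\<close>
  define f' where "f' t x = frechet_derivative (\<phi> t t0) (at x)" for t x
  define S where "S = {z. \<forall>t\<in>J. norm (f' t x0 z) \<le> exp (\<alpha> * (t - t0))}"
  have J: "compact J" and U: "open (X t0)" and id: "\<And>x. x \<in> X t0 \<Longrightarrow> \<phi> t0 t0 x = x"
    and C2: "Ck_family (Suc (Suc 0)) J X \<phi>"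
    using assms t0 by (auto simp: Ck_ftnds_def ftnds_def numeral_2_eq_2)
  have f': "(\<phi> t t0 has_derivative f' t x) (at x)" if "t \<in> J" "x \<in> X t0" for t x
    using C2 that t0 unfolding f'_def by (simp flip: frechet_derivative_works)
  have cont: "continuous_on (J \<times> X t0) (\<lambda>(t, x). f' t x v)" for v
  proof -
    have "continuous_on (J \<times> Sigma J X) (\<lambda>(t, s, x). frechet_derivative (\<phi> t s) (at x) v)"
      using C2 by simp
    \<comment> \<open>Joint continuity is pulled back along the slice with initial time
      \<open>t0\<close>.\<close>
    then have "continuous_on (J \<times> X t0)
        ((\<lambda>(t, s, x). frechet_derivative (\<phi> t s) (at x) v) \<circ> (\<lambda>(t, x). (t, t0, x)))"
      using t0 by (intro continuous_on_compose)
        (auto simp: case_prod_unfold intro!: continuous_intros elim!: continuous_on_subset)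
    then show ?thesis
      by (simp add: f'_def o_def case_prod_unfold)
  qed
  have lin: "linear (f' t x0)" if "t \<in> J" for t
    using f'[OF that x0] by (rule has_derivative_linear)
  \<comment> \<open>Near \<open>x0\<close> the map \<open>\<phi> t0 t0\<close> is the identity,
    because \<open>X t0\<close> is open; derivatives are unique.\<close>
  have f'_t0: "f' t0 x0 = (\<lambda>z. z)"
    using has_derivative_unique[OF f'[OF t0 x0]
        has_derivative_transform_within_open[OF has_derivative_ident U x0]] id by auto
  \<comment> \<open>The second factor of \<open>linearization\<close> inverts the derivative at
    \<open>t0\<close>, which is the identity. As \<open>matrix_inv\<close> is a choice, uniqueness
    of the inverse of \<open>mat 1\<close> is part of the argument.\<close>
  have linearization: "linearization \<phi> t0 x0 t t0 *v z = f' t x0 z" if "t \<in> J" for t z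
  proof -
    have "matrix_inv (mat 1 :: real^'n^'n) = mat 1"
      unfolding matrix_inv_def by (rule some_equality) auto
    moreover have "matrix (f' t0 x0) = (mat 1 :: real^'n^'n)"
      by (simp add: f'_t0 matrix_def mat_def axis_def vec_eq_iff)
    ultimately show ?thesis
      using matrix_works[of "f' t x0"] lin[OF that]
      by (simp add: linearization_def flip: f'_def)
  qed

  \<comment> \<open>Compactness and positive measure of the limit shape \<open>S\<close>\<close>
  obtain m where m: "m > 0" "\<And>t. t \<in> J \<Longrightarrow> m \<le> exp (\<alpha> * (t - t0))"
  proof -
    \<comment> \<open>The minimum of the weight over \<open>J\<close> serves twice: to fit a small
      ball into \<open>S\<close>, and to make the Taylor error small relative to the weight at every
      time.\<close>
    have "continuous_on J (\<lambda>t. exp (\<alpha> * (t - t0)))"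
      by (intro continuous_intros)
    from continuous_attains_inf[OF J _ this] t0
    obtain s where "\<forall>t\<in>J. exp (\<alpha> * (s - t0)) \<le> exp (\<alpha> * (t - t0))"
      by blast
    then show ?thesis
      by (intro that[of "exp (\<alpha> * (s - t0))"]) auto
  qed

  \<comment> \<open>At \<open>t = t0\<close> the derivative is the identity and the weight is
    1.\<close>
  have S_unit: "norm z \<le> 1" if "z \<in> S" for z
    using that t0 by (auto simp: S_def f'_t0 dest: bspec[of _ _ t0])
  have "S = (\<Inter>t\<in>J. {z. norm (f' t x0 z) \<le> exp (\<alpha> * (t - t0))})"
    by (auto simp: S_def)
  moreover have "continuous_on UNIV (f' t x0)" if "t \<in> J" for t
    using lin[OF that] by (simp add: linear_continuous_on linear_conv_bounded_linear)
  ultimately have "closed S"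
    by (auto intro!: closed_INT closed_Collect_le continuous_on_norm)
  then have S: "compact S"
    using S_unit by (auto simp: compact_eq_bounded_closed bounded_iff)
  have S_pos: "0 < measure lebesgue S"
  proof -
    \<comment> \<open>Bounds on single directions, from continuity in \<open>t\<close> on
      \<open>J\<close>, combine over \<open>Basis\<close> to a bound \<open>K\<close> on the
      operator norms uniform in \<open>t\<close>.\<close>
    have "\<exists>C. \<forall>t\<in>J. norm (f' t x0 v) \<le> C" for v
    proof -
      have "continuous_on J ((\<lambda>(t, x). f' t x v) \<circ> (\<lambda>t. (t, x0)))"
        using x0 by (intro continuous_on_compose)
          (auto intro!: continuous_intros continuous_on_subset[OF cont])
      then have "bounded ((\<lambda>t. f' t x0 v) ` J)"
        using J by (intro compact_imp_bounded compact_continuous_image) (auto simp: o_def)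
      then show ?thesis by (auto simp: bounded_iff)
    qed
    then obtain C where C: "\<And>v t. t \<in> J \<Longrightarrow> norm (f' t x0 v) \<le> C v"
      by metis
    define K where "K = (\<Sum>v\<in>Basis. C v)"
    have K: "norm (f' t x0 z) \<le> K * norm z" if "t \<in> J" for t z
    proof -
      have bl: "bounded_linear (f' t x0)"
        using lin[OF that] by (simp add: linear_conv_bounded_linear)
      have "onorm (f' t x0) \<le> K"
        unfolding K_def using C[OF that] by (intro onorm_componentwise_le[OF bl] sum_mono)
      then show ?thesis
        using onorm[OF bl, of z] by (meson mult_right_mono norm_ge_zero order_trans)
    qed
    have "K \<ge> 0"
      unfolding K_def using C[OF t0] by (intro sum_nonneg) (meson norm_ge_zero order_trans)
    \<comment> \<open>With \<open>K + 1\<close> the denominator is positive knowing only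
      \<open>K \<ge> 0\<close>.\<close>
    have "cball 0 (m / (K + 1)) \<subseteq> S"
    proof
      fix z :: "real^'n" assume z: "z \<in> cball 0 (m / (K + 1))"
      have "norm (f' t x0 z) \<le> exp (\<alpha> * (t - t0))" if "t \<in> J" for t
      proof -
        have "norm (f' t x0 z) \<le> (K + 1) * norm z"
          using K[OF that, of z] norm_ge_zero[of z] unfolding distrib_right by linarith
        also have "\<dots> \<le> m"
          using z \<open>K \<ge> 0\<close> by (simp add: field_simps)
        finally show ?thesis using m(2)[OF that] by simp
      qed
      then show "z \<in> S" by (simp add: S_def)
    qed
    then have "measure lebesgue (cball (0::real^'n) (m / (K + 1))) \<le> measure lebesgue S"
      using lmeasurable_compact[OF S] by (intro measure_mono_fmeasurable) auto
    moreover have "0 < m / (K + 1)"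
      using m(1) \<open>K \<ge> 0\<close> by simp
    from content_cball_pos[OF this, of "0::real^'n"]
    have "0 < measure lebesgue (cball (0::real^'n) (m / (K + 1)))"
      by simp
    ultimately show ?thesis
      by (rule order.strict_trans2[rotated])
  qed

  \<comment> \<open>Measurability of small finite-time balls\<close>
  let ?B = "ft_ball J X \<phi> \<alpha> t0 x0"
  \<comment> \<open>This is the constraint at time \<open>t0\<close>, where the flow map is the
    identity and the weight is 1.\<close>
  have B_near: "norm (x - x0) \<le> \<epsilon>" if "x \<in> ?B \<epsilon>" for x \<epsilon>
    using that t0 x0 id by (auto simp: mem_ft_ball_iff dest: bspec[of _ _ t0])

  have meas: "\<forall>\<^sub>F \<epsilon> in at_right 0. ?B \<epsilon> \<in> lmeasurable"
  proof -
    obtain r where r: "r > 0" "cball x0 r \<subseteq> X t0"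
      using U x0 open_contains_cball by blast
    have "?B \<epsilon> \<in> lmeasurable" if \<epsilon>: "\<epsilon> < r" for \<epsilon>
    proof -
      \<comment> \<open>The fibre \<open>X t0\<close> is open, not closed; replacing it by a closed
        ball that already contains \<open>?B \<epsilon>\<close> exhibits
        \<open>?B \<epsilon>\<close> as compact.\<close>
      have "?B \<epsilon> = cball x0 r \<inter>
          (\<Inter>t\<in>J. {x \<in> cball x0 r. norm (\<phi> t t0 x - \<phi> t t0 x0) \<le> \<epsilon> * exp (\<alpha> * (t - t0))})"
        using B_near \<epsilon> r(2) by (fastforce simp: mem_ft_ball_iff dist_norm norm_minus_commute)
      moreover have "closed {x \<in> cball x0 r. norm (\<phi> t t0 x - \<phi> t t0 x0) \<le> \<epsilon> * exp (\<alpha> * (t - t0))}"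
        if "t \<in> J" for t
      proof -
        have "continuous_on (cball x0 r) (\<phi> t t0)"
          using f'[OF that] r(2)
          by (meson has_derivative_continuous continuous_at_imp_continuous_on subsetD)
        then show ?thesis
          by (intro continuous_on_closed_Collect_le continuous_intros closed_cball)
      qed
      ultimately have "compact (?B \<epsilon>)"
        by (metis (no_types, lifting) closed_INT compact_Int_closed compact_cball)
      then show ?thesis by (rule lmeasurable_compact)
    qed
    then show ?thesis
      unfolding eventually_at_right_field using r(1) by blast
  qed

  \<comment> \<open>Inclusions between finite-time balls and scaled copies of
    \<open>S\<close>\<close>
  have sandwich: "\<forall>\<^sub>F \<epsilon> in at_right 0. (\<lambda>z. (\<epsilon> * (1 - \<kappa>)) *\<^sub>R z + x0) ` S \<subseteq> ?B \<epsilon> \<and>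
      ?B \<epsilon> \<subseteq> (\<lambda>z. (\<epsilon> * (1 + \<kappa>)) *\<^sub>R z + x0) ` S" if \<kappa>: "0 < \<kappa>" "\<kappa> < 1" for \<kappa>
  proof -
    \<comment> \<open>As \<open>m\<close> lies below every weight, this accuracy keeps the Taylor
      error within the share \<kappa> of the radius
      \<open>\<epsilon> * exp (\<alpha> * (t - t0))\<close> allowed at time
      \<open>t\<close>.\<close>
    have "0 < \<kappa> * m" using \<kappa> m by simp
    from uniform_linear_approximation[of J "X t0" x0 "\<lambda>t. \<phi> t t0" f', OF J U x0 f' cont this]
    obtain \<delta> where \<delta>: "\<delta> > 0" "cball x0 \<delta> \<subseteq> X t0" and approx: "\<And>t x. t \<in> J \<Longrightarrow> x \<in> cball x0 \<delta> \<Longrightarrow>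
        norm (\<phi> t t0 x - \<phi> t t0 x0 - f' t x0 (x - x0)) \<le> \<kappa> * m * norm (x - x0)"
      by blast
    have err: "norm (\<phi> t t0 x - \<phi> t t0 x0 - f' t x0 (x - x0)) \<le> \<epsilon> * \<kappa> * exp (\<alpha> * (t - t0))"
      if "t \<in> J" "norm (x - x0) \<le> \<epsilon>" "0 < \<epsilon>" "\<epsilon> < \<delta>" for t x \<epsilon>
    proof -
      have "\<kappa> * m * norm (x - x0) \<le> \<kappa> * exp (\<alpha> * (t - t0)) * \<epsilon>"
        using that \<kappa> m by (intro mult_mono) auto
      then show ?thesis
        using approx[of t x] that by (simp add: dist_norm norm_minus_commute mult_ac)
    qed
    have "(\<lambda>z. (\<epsilon> * (1 - \<kappa>)) *\<^sub>R z + x0) ` S \<subseteq> ?B \<epsilon> \<and> ?B \<epsilon> \<subseteq> (\<lambda>z. (\<epsilon> * (1 + \<kappa>)) *\<^sub>R z + x0) ` S"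
      if \<epsilon>: "0 < \<epsilon>" "\<epsilon> < \<delta>" for \<epsilon>
    proof (intro conjI subsetI)
      fix x assume "x \<in> (\<lambda>z. (\<epsilon> * (1 - \<kappa>)) *\<^sub>R z + x0) ` S"
      then obtain z where z: "z \<in> S" and x: "x - x0 = (\<epsilon> * (1 - \<kappa>)) *\<^sub>R z"
        by auto
      have "(1 - \<kappa>) * norm z \<le> 1 * 1"
        using \<kappa> S_unit[OF z] by (intro mult_mono) auto
      then have nx: "norm (x - x0) \<le> \<epsilon>"
        using \<epsilon> \<kappa> by (simp add: x abs_mult)
      have "norm (\<phi> t t0 x - \<phi> t t0 x0) \<le> \<epsilon> * exp (\<alpha> * (t - t0))" if t: "t \<in> J" for t
      proof -
        \<comment> \<open>The linear part takes the share \<open>1 - \<kappa>\<close> of the allowed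
          radius, leaving exactly the share \<kappa> for the error.\<close>
        have "norm (f' t x0 (x - x0)) = \<epsilon> * (1 - \<kappa>) * norm (f' t x0 z)"
          using \<epsilon> \<kappa> by (simp add: x linear_scale[OF lin[OF t]] abs_mult)
        also have "\<dots> \<le> \<epsilon> * (1 - \<kappa>) * exp (\<alpha> * (t - t0))"
          using \<epsilon> \<kappa> z t by (intro mult_left_mono) (auto simp: S_def)
        finally show ?thesis
          using err[OF t nx \<epsilon>] norm_triangle_sub[of "\<phi> t t0 x - \<phi> t t0 x0" "f' t x0 (x - x0)"]
          by (simp add: algebra_simps)
      qed
      moreover have "x \<in> X t0"
        using nx \<epsilon> \<delta> by (auto simp: dist_norm norm_minus_commute)
      ultimately show "x \<in> ?B \<epsilon>"
        by (simp add: mem_ft_ball_iff)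
    next
      fix x assume x: "x \<in> ?B \<epsilon>"
      \<comment> \<open>Conversely, the linear part can exceed the allowed radius by at most the
        share \<kappa>; rescaling by \<open>\<epsilon> * (1 + \<kappa>)\<close> absorbs this
        excess.\<close>
      define z where "z = (1 / (\<epsilon> * (1 + \<kappa>))) *\<^sub>R (x - x0)"
      have "norm (f' t x0 z) \<le> exp (\<alpha> * (t - t0))" if t: "t \<in> J" for t
      proof -
        have "norm (f' t x0 (x - x0)) \<le> \<epsilon> * (1 + \<kappa>) * exp (\<alpha> * (t - t0))"
          using err[OF t B_near[OF x] \<epsilon>] x t
            norm_triangle_sub[of "f' t x0 (x - x0)" "\<phi> t t0 x - \<phi> t t0 x0"]
          by (auto simp: mem_ft_ball_iff norm_minus_commute algebra_simps dest: bspec[of _ _ t])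
        moreover have "norm (f' t x0 z) = norm (f' t x0 (x - x0)) / (\<epsilon> * (1 + \<kappa>))"
          using \<epsilon> \<kappa> by (simp add: z_def linear_scale[OF lin[OF t]] abs_mult)
        ultimately show ?thesis
          using \<epsilon> \<kappa> by (simp add: pos_divide_le_eq mult.commute)
      qed
      moreover have "x = (\<epsilon> * (1 + \<kappa>)) *\<^sub>R z + x0"
        using \<epsilon> \<kappa> by (simp add: z_def)
      ultimately show "x \<in> (\<lambda>z. (\<epsilon> * (1 + \<kappa>)) *\<^sub>R z + x0) ` S"
        by (auto simp: S_def)
    qed
    then show ?thesis
      unfolding eventually_at_right_field using \<delta>(1) by blast
  qed

  \<comment> \<open>Passage to the limit and comparison with the linear system\<close>
  let ?b = "measure lebesgue (cball (0::real^'n) 1)"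
  have b: "0 < ?b"
    using content_cball_pos[of 1 "0::real^'n"] by simp
  have "((\<lambda>\<epsilon>. measure lebesgue (?B \<epsilon>) / measure lebesgue (cball x0 \<epsilon>)) \<longlongrightarrow>
      measure lebesgue S / ?b) (at_right 0)"
    using meas sandwich by (intro tendsto_measure_ratio_sandwich S) (auto elim: eventually_mono)
  then have "ftme J X \<phi> \<alpha> t0 x0 =
      ereal (- (1 / time_length J)) * ereal (ln (measure lebesgue S / ?b))"
    using meas S_pos b by (intro ftme_eq_of_tendsto) auto
  \<comment> \<open>The real limit is rewritten in extended form to match
    \<open>ftme_linear_flow\<close>, whose right-hand side is free of the base point
    \<open>y\<close>.\<close>
  also have "ereal (ln (measure lebesgue S / ?b)) =
      ln_ennreal (emeasure lebesgue S / emeasure lebesgue (cball (0::real^'n) 1))"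
    using S_pos b lmeasurable_compact[OF S]
    by (simp only: emeasure_divide_eq_measure lmeasurable_cball ln_ennreal_ennreal divide_pos_pos)
  also have "S = {z. \<forall>t\<in>J. norm (linearization \<phi> t0 x0 t t0 *v z) \<le> exp (\<alpha> * (t - t0))}"
    by (simp add: S_def linearization)
  finally show "ftme J X \<phi> \<alpha> t0 x0 =
      ftme J (\<lambda>_. UNIV) (linear_flow (linearization \<phi> t0 x0)) \<alpha> t0 y"
    by (simp only: ftme_linear_flow)
qed

end
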